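(* Let $n$ and $h$ be positive integers such that $$h^2\equiv 0\pmod{n}\quad\text{and}\quad(\nu_2(h),\nu_2(n))\neq(1,1).$$ Define $$k=\begin{cases} n/h & \text{if } \nu_2(n)\neq 1,\\ 2n/h & \text{otherwise,}\end{cases}$$ and assume $k$ is a positive integer dividing $n$. Suppose that $G$ is a group of order $n$ which contains a normal subgroup isomorphic to the cyclic group $\mathbb{Z}_{n/k}$ of order $n/k$. Then a $\mathrm{BH}(G,h)$ matrix exists.
   Context: $\nu_2(x)$ denotes the $2$-adic valuation of the integer $x$. For a finite group $G$, a $|G|\times|G|$ matrix $A=(a_{g,k})_{g,k\in G}$ is $G$-invariant if $a_{gl,kl}=a_{g,k}$ for all $g,k,l\in G$. A $\mathrm{BH}(G,h)$ matrix is a $G$-invariant $|G|\times |G|$ matrix $H$ all of whose entries are complex $h$th roots of unity and which satisfies $HH^*=|G|I_{|G|}$, where $H^*$ is the conjugate transpose and $I_{|G|}$ the identity matrix. *)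

theory Defs
  imports
    Complex_Main
    "HOL-Number_Theory.Cong"
    "HOL-Computational_Algebra.Primes"
    "HOL-Algebra.Coset"
    "HOL-Algebra.Elementary_Groups"
begin

text \<open>
  A \<open>|G| \<times> |G|\<close> matrix with rows and columns indexed by the elements of \<open>G\<close> is a function
  \<open>A :: 'a \<Rightarrow> 'a \<Rightarrow> complex\<close> of which only the values on \<open>carrier G\<close> matter.
\<close>

definition group_invariant :: "('a, 'm) monoid_scheme \<Rightarrow> ('a \<Rightarrow> 'a \<Rightarrow> complex) \<Rightarrow> bool" where
  "group_invariant G A \<longleftrightarrow>
     (\<forall>g\<in>carrier G. \<forall>k\<in>carrier G. \<forall>l\<in>carrier G.
        A (g \<otimes>\<^bsub>G\<^esub> l) (k \<otimes>\<^bsub>G\<^esub> l) = A g k)"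

text \<open>
  The last conjunct is \<open>H H\<^sup>* = |G| I\<close>, read entrywise; \<open>H\<^sup>*\<close> has \<open>(l, k)\<close> entry \<open>cnj (H k l)\<close>.
  The predicate is meant for \<open>h > 0\<close>: every complex number satisfies \<open>z ^ 0 = 1\<close>.
\<close>

definition BH_matrix :: "('a, 'm) monoid_scheme \<Rightarrow> nat \<Rightarrow> ('a \<Rightarrow> 'a \<Rightarrow> complex) \<Rightarrow> bool" where
  "BH_matrix G h H \<longleftrightarrow>
     finite (carrier G) \<and>
     group_invariant G H \<and>
     (\<forall>g\<in>carrier G. \<forall>k\<in>carrier G. H g k ^ h = 1) \<and>
     (\<forall>g\<in>carrier G. \<forall>k\<in>carrier G.
        (\<Sum>l\<in>carrier G. H g l * cnj (H k l)) = (if g = k then of_nat (order G) else 0))"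

end

theory Submission
  imports Defs "HOL-Algebra.Multiplicative_Group"
begin

text \<open>
  Let \<open>z\<close> generate \<open>N\<close>, of order \<open>k m\<close> and index \<open>k\<close>, and let \<open>\<omega>\<close> be a primitive \<open>H\<close>-th root of unity.
  On the coset \<open>C\<close> with representative \<open>t\<close> put
  \<open>f (z\<^sup>j t) = \<omega> ^ (B a(C) j + A j\<^sup>2)\<close>: a character of \<open>N\<close> depending on \<open>C\<close> times a fixed perfect
  quadratic phase of period \<open>m\<close>. For \<open>g\<close> in \<open>N\<close> the autocorrelation of \<open>f\<close> at \<open>g\<close> vanishes if the labels
  \<open>a(C)\<close> are distinct modulo \<open>k\<close>. For \<open>g\<close> outside \<open>N\<close>, conjugation by \<open>g\<close> raises \<open>z\<close> to the power
  \<open>v g\<close>, and the autocorrelation vanishes if also the products \<open>a(C) v(C)\<close> are distinct modulo \<open>k\<close>.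

  Such labels exist by induction on \<open>k\<close>: the fibres of \<open>v\<close> modulo \<open>k\<close> have equal size, and they are
  fewer than \<open>k\<close> in number because their values are units, so they can be labelled first.
\<close>

subsection \<open>Roots of unity\<close>

definition root_of_unity :: "nat \<Rightarrow> complex" where
  "root_of_unity H = cis (2 * pi / real H)"

lemma root_of_unity_pow_eq_1_iff:
  assumes "H > 0"
  shows "root_of_unity H ^ i = 1 \<longleftrightarrow> H dvd i"
proof
  assume "root_of_unity H ^ i = 1"
  then have "cos (real i * (2 * pi / real H)) = 1"
    by (simp add: root_of_unity_def DeMoivre complex_eq_iff)
  then obtain n :: int where "real i * (2 * pi / real H) = of_int n * 2 * pi"
    unfolding cos_one_2pi_int by blast
  then have "real i = n * real H"
    using assms by (simp add: field_simps)
  then have "int i = n * int H"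
    by (metis of_int_eq_iff of_int_mult of_int_of_nat_eq)
  then show "H dvd i"
    by (metis dvd_triv_right int_dvd_int_iff)
next
  assume "H dvd i"
  then obtain c where "i = H * c" ..
  moreover have "root_of_unity H ^ H = 1"
    using assms by (simp add: root_of_unity_def DeMoivre complex_eq_iff)
  ultimately show "root_of_unity H ^ i = 1"
    by (simp add: power_mult)
qed

lemma root_of_unity_nonzero [simp]: "root_of_unity H \<noteq> 0"
  by (simp add: root_of_unity_def)

lemma root_of_unity_mult_cnj [simp]: "root_of_unity H ^ i * cnj (root_of_unity H ^ i) = 1"
  by (simp add: root_of_unity_def DeMoivre cis_cnj cis_mult)

lemma root_of_unity_add_mult_cnj:
  "root_of_unity H ^ (i + j) * cnj (root_of_unity H ^ j) = root_of_unity H ^ i"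
  by (simp only: power_add mult.assoc root_of_unity_mult_cnj mult_1_right)

lemma root_of_unity_pow_eq_iff:
  assumes "H > 0"
  shows "root_of_unity H ^ i = root_of_unity H ^ j \<longleftrightarrow> [i = j] (mod H)"
proof -
  have *: "root_of_unity H ^ i = root_of_unity H ^ j \<longleftrightarrow> [i = j] (mod H)" if "i \<le> j" for i j
  proof -
    have "root_of_unity H ^ j = root_of_unity H ^ i * root_of_unity H ^ (j - i)"
      using that by (simp flip: power_add)
    then have "root_of_unity H ^ i = root_of_unity H ^ j \<longleftrightarrow> root_of_unity H ^ (j - i) = 1"
      by auto
    also have "\<dots> \<longleftrightarrow> [i = j] (mod H)"
      using that assms by (simp add: root_of_unity_pow_eq_1_iff cong_sym_eq[of i] cong_altdef_nat)
    finally show ?thesis .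
  qed
  show ?thesis
    using *[of i j] *[of j i] by (cases "i \<le> j") (auto simp: cong_sym_eq)
qed

lemma sum_powers_eq_0:
  fixes \<rho> :: complex
  assumes "\<rho> ^ k = 1" "\<rho> \<noteq> 1"
  shows "(\<Sum>i<k. \<rho> ^ i) = 0"
  using geometric_sum[OF assms(2), of k] assms(1) by simp

subsection \<open>Twisted labellings\<close>

text \<open>Empty fibres are left out of the comparison, as \<open>u\<close> takes only some of the
  unit residues. Asking this for every divisor of \<open>k\<close> lets the condition survive the
  descent to \<open>k'\<close>.\<close>

definition equidistributed_mod :: "'a set \<Rightarrow> ('a \<Rightarrow> nat) \<Rightarrow> nat \<Rightarrow> bool" where
  "equidistributed_mod X u d \<longleftrightarrow>
     (\<exists>c. \<forall>x\<in>X. card {w \<in> X. [u w = u x] (mod d)} = c)"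

text \<open>When \<open>card X = k\<close>, injectivity makes both \<open>a\<close> and
  \<open>a * u\<close> run exactly once through the residues modulo \<open>k\<close>.\<close>

definition twisted_labelling :: "'a set \<Rightarrow> ('a \<Rightarrow> nat) \<Rightarrow> nat \<Rightarrow> ('a \<Rightarrow> nat) \<Rightarrow> bool" where
  "twisted_labelling X u k a \<longleftrightarrow>
     (\<forall>x\<in>X. \<forall>y\<in>X. [a x = a y] (mod k) \<longrightarrow> x = y) \<and>
     (\<forall>x\<in>X. \<forall>y\<in>X. [a x * u x = a y * u y] (mod k) \<longrightarrow> x = y)"

text \<open>Contract each fibre of \<open>u\<close> modulo \<open>k\<close> to a point. As there are \<open>k' < k\<close> fibres, all of the same
  size \<open>r = k / k'\<close>, a labelling \<open>a'\<close> of the fibres modulo \<open>k'\<close> lifts to \<open>a' + k' j\<close> with \<open>j < r\<close>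
  numbering the elements of a fibre, on which the units \<open>u\<close> agree modulo \<open>k\<close>.\<close>

lemma twisted_labelling_step:
  fixes X :: "'a set" and u :: "'a \<Rightarrow> nat"
  assumes "finite X" "card X = k" "k > 0" and cop: "\<And>x. x \<in> X \<Longrightarrow> coprime (u x) k"
    and eq: "\<And>d. d dvd k \<Longrightarrow> equidistributed_mod X u d"
    and IH: "\<And>V k'. k' < k \<Longrightarrow> finite V \<Longrightarrow> card V = k' \<Longrightarrow> k' > 0 \<Longrightarrow>
      (\<And>x. x \<in> V \<Longrightarrow> coprime x k') \<Longrightarrow>
      (\<And>d. d dvd k' \<Longrightarrow> equidistributed_mod V (\<lambda>v. v) d) \<Longrightarrow>
      \<exists>a. twisted_labelling V (\<lambda>v. v) k' a"
  shows "\<exists>a. twisted_labelling X u k a"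
proof (cases "k = 1")
  case True
  then obtain x where "X = {x}"
    using \<open>card X = k\<close> card_1_singletonE by blast
  then show ?thesis
    by (simp add: twisted_labelling_def)
next
  case False
  with \<open>k > 0\<close> have "k > 1" by simp
  define p where "p x = u x mod k" for x
  define V where "V = p ` X"
  have "X \<noteq> {}" using assms by auto
  have finV: "finite V" using \<open>finite X\<close> by (simp add: V_def)
  obtain r where r: "card {w \<in> X. [u w = u x] (mod k)} = r" if "x \<in> X" for x
    using eq[of k] by (auto simp: equidistributed_mod_def)
  have r': "card {w \<in> X. p w = v} = r" if "v \<in> V" for v
    using that r by (auto simp: V_def p_def cong_def)
  \<comment> \<open>A count over \<open>X\<close> depending only on the residue \<open>p x\<close>
    is \<open>r\<close> times the count over residues; this yields both \<open>k = r * k'\<close>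
    and the equidistribution of \<open>V\<close>.\<close>
  have fib: "card {x \<in> X. P (p x)} = r * card {v \<in> V. P v}" for P
  proof -
    have "card {x \<in> X. P (p x)} = (\<Sum>v\<in>p ` {x \<in> X. P (p x)}. card {w \<in> {x \<in> X. P (p x)}. p w = v})"
      using sum.image_gen[of "{x \<in> X. P (p x)}" "\<lambda>_. 1::nat" p] \<open>finite X\<close> by simp
    also have "p ` {x \<in> X. P (p x)} = {v \<in> V. P v}"
      by (auto simp: V_def)
    also have "(\<Sum>v\<in>{v \<in> V. P v}. card {w \<in> {x \<in> X. P (p x)}. p w = v}) = (\<Sum>v\<in>{v \<in> V. P v}. r)"
    proof (rule sum.cong)
      fix v assume v: "v \<in> {v \<in> V. P v}"
      then have "{w \<in> {x \<in> X. P (p x)}. p w = v} = {w \<in> X. p w = v}" by auto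
      with v r' show "card {w \<in> {x \<in> X. P (p x)}. p w = v} = r" by auto
    qed simp
    finally show ?thesis by simp
  qed
  define k' where "k' = card V"
  have k: "k = r * k'"
    using fib[of "\<lambda>_. True"] \<open>card X = k\<close> by (simp add: k'_def)
  with \<open>k > 0\<close> have "r > 0" "k' > 0" by auto
  have Vcop: "coprime v k" if "v \<in> V" for v
    using that cop \<open>k > 0\<close> by (auto simp: V_def p_def)
  \<comment> \<open>Zero is no unit modulo \<open>k > 1\<close>, so at most \<open>k - 1\<close>
    residues occur and the induction descends strictly.\<close>
  have "V \<subseteq> {1..<k}"
  proof
    fix v assume "v \<in> V"
    with Vcop \<open>k > 1\<close> have "v \<noteq> 0" by (metis coprime_0_left_iff less_not_refl nat_dvd_1_iff_1)
    moreover have "v < k" using \<open>v \<in> V\<close> \<open>k > 0\<close> by (auto simp: V_def p_def)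
    ultimately show "v \<in> {1..<k}" by simp
  qed
  then have "k' \<le> card {1..<k}"
    unfolding k'_def by (intro card_mono) auto
  with \<open>k > 1\<close> have "k' < k" by simp
  have "\<exists>a. twisted_labelling V (\<lambda>v. v) k' a"
  proof (rule IH[OF \<open>k' < k\<close> finV])
    show "coprime v k'" if "v \<in> V" for v
      using Vcop[OF that] by (simp add: k)
    show "equidistributed_mod V (\<lambda>v. v) d" if "d dvd k'" for d
    proof -
      have "d dvd k" using that by (simp add: k)
      then obtain c where c: "card {w \<in> X. [u w = u x] (mod d)} = c" if "x \<in> X" for x
        using eq[of d] by (auto simp: equidistributed_mod_def)
      have "card {w \<in> V. [w = v] (mod d)} = c div r" if "v \<in> V" for v
      proof -
        obtain x where x: "x \<in> X" "v = p x" using \<open>v \<in> V\<close> by (auto simp: V_def)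
        have "{w \<in> X. [u w = u x] (mod d)} = {w \<in> X. [p w = v] (mod d)}"
          using \<open>d dvd k\<close> by (auto simp: x p_def cong_def mod_mod_cancel)
        then have "c = r * card {w \<in> V. [w = v] (mod d)}"
          using c[OF \<open>x \<in> X\<close>] fib[of "\<lambda>w. [w = v] (mod d)"] by simp
        with \<open>r > 0\<close> show ?thesis by simp
      qed
      then show ?thesis by (auto simp: equidistributed_mod_def)
    qed
  qed (use \<open>k' > 0\<close> in \<open>auto simp: k'_def\<close>)
  then obtain a' where a': "twisted_labelling V (\<lambda>v. v) k' a'" ..
  have a1: "x = y" if "x \<in> V" "y \<in> V" "[a' x = a' y] (mod k')" for x y
    using a' that by (simp add: twisted_labelling_def)
  have a2: "x = y" if "x \<in> V" "y \<in> V" "[a' x * x = a' y * y] (mod k')" for x y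
    using a' that by (simp add: twisted_labelling_def)
  have "\<exists>b. bij_betw b {w \<in> X. p w = v} {0..<r}" if "v \<in> V" for v
    using ex_bij_betw_finite_nat[of "{w \<in> X. p w = v}"] r'[OF that] \<open>finite X\<close> by auto
  then obtain b where b: "\<And>v. v \<in> V \<Longrightarrow> bij_betw (b v) {w \<in> X. p w = v} {0..<r}"
    by metis
  define a where "a x = a' (p x) + k' * b (p x) x" for x
  have ak': "[a x = a' (p x)] (mod k')" for x
    by (simp add: a_def cong_def)
  have uk': "[u x = p x] (mod k')" for x
    unfolding p_def cong_def by (simp add: k mod_mod_cancel)
  \<comment> \<open>Within one fibre \<open>a'\<close> cancels, and \<open>k' * b\<close> modulo
    \<open>k' * r\<close> determines \<open>b\<close> modulo \<open>r\<close>, hence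
    \<open>b\<close> itself.\<close>
  have inj: "x = y" if "x \<in> X" "y \<in> X" "[a x = a y] (mod k)" "p x = p y" for x y
  proof -
    have "p x \<in> V" using that by (auto simp: V_def)
    note bb = b[OF this]
    have "[k' * b (p x) x = k' * b (p x) y] (mod k' * r)"
      using that(3) by (simp add: a_def that(4) cong_add_lcancel_nat k mult.commute)
    then have "[b (p x) x = b (p x) y] (mod r)"
      using \<open>k' > 0\<close> by (simp add: cong_def mult_mod_right[symmetric])
    moreover have "b (p x) x < r" "b (p x) y < r"
      using bij_betw_apply[OF bb, of x] bij_betw_apply[OF bb, of y] that by auto
    ultimately have "b (p x) x = b (p x) y"
      by (simp add: cong_def)
    then show "x = y"
      using bij_betw_imp_inj_on[OF bb] that by (auto dest: inj_onD)
  qed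
  have "twisted_labelling X u k a"
    unfolding twisted_labelling_def
  proof (intro conjI ballI impI)
    fix x y assume xy: "x \<in> X" "y \<in> X"
    then have pV: "p x \<in> V" "p y \<in> V" by (auto simp: V_def)
    show "x = y" if c: "[a x = a y] (mod k)"
    proof -
      have "[a x = a y] (mod k')" using c by (metis cong_dvd_modulus_nat dvd_triv_right k)
      then have "[a' (p x) = a' (p y)] (mod k')"
        using ak' by (meson cong_sym cong_trans)
      then show ?thesis
        using a1 pV inj xy c by blast
    qed
    \<comment> \<open>Reducing modulo \<open>k'\<close> identifies the fibre, by the twisted
      property of \<open>a'\<close>; on one fibre the unit \<open>u x\<close> can be cancelled
      modulo \<open>k\<close>.\<close>
    show "x = y" if c: "[a x * u x = a y * u y] (mod k)"
    proof -
      have "[a x * u x = a y * u y] (mod k')" using c by (metis cong_dvd_modulus_nat dvd_triv_right k)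
      then have "[a' (p x) * p x = a' (p y) * p y] (mod k')"
        using cong_mult[OF ak' uk'] by (meson cong_sym cong_trans)
      then have p: "p x = p y" using a2 pV by blast
      then have "[u x = u y] (mod k)" by (simp add: p_def cong_def)
      then have "[a y * u y = a y * u x] (mod k)" by (intro cong_mult) (auto simp: cong_sym_eq)
      with c have "[a x * u x = a y * u x] (mod k)" by (rule cong_trans)
      then have "[a x = a y] (mod k)"
        using cop[OF xy(1)] by (simp add: cong_mult_rcancel_nat)
      then show ?thesis using inj xy p by blast
    qed
  qed
  then show ?thesis by blast
qed

text \<open>One contraction replaces \<open>X\<close> by a set of residues and \<open>u\<close> by
  the identity, so the strong induction runs entirely over sets of naturals.\<close>

lemma twisted_labelling_nat_exists:
  fixes V :: "nat set"
  assumes "finite V" "card V = k" "k > 0" "\<And>x. x \<in> V \<Longrightarrow> coprime x k"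
    and "\<And>d. d dvd k \<Longrightarrow> equidistributed_mod V (\<lambda>v. v) d"
  shows "\<exists>a. twisted_labelling V (\<lambda>v. v) k a"
  using assms
proof (induction k arbitrary: V rule: less_induct)
  case (less k)
  show ?case
    by (rule twisted_labelling_step) (use less in auto)
qed

lemma twisted_labelling_exists:
  fixes X :: "'a set" and u :: "'a \<Rightarrow> nat"
  assumes "finite X" "card X = k" "k > 0" "\<And>x. x \<in> X \<Longrightarrow> coprime (u x) k"
    and "\<And>d. d dvd k \<Longrightarrow> equidistributed_mod X u d"
  shows "\<exists>a. twisted_labelling X u k a"
  by (rule twisted_labelling_step) (use assms twisted_labelling_nat_exists in auto)

subsection \<open>Groups with a normal cyclic subgroup\<close>

context group
begin

lemma nat_pow_eq_iff_cong:
  assumes "z \<in> carrier G"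
  shows "z [^] (i::nat) = z [^] j \<longleftrightarrow> [i = j] (mod ord z)"
  using int_pow_eq[OF assms, of "int i" "int j"]
  by (simp add: int_pow_int cong_int_iff[symmetric] cong_iff_dvd_diff dvd_diff_commute)

lemma nat_pow_conj:
  assumes "g \<in> carrier G" "z \<in> carrier G"
  shows "g \<otimes> z [^] (i::nat) \<otimes> inv g = (g \<otimes> z \<otimes> inv g) [^] i"
proof (induction i)
  case (Suc i)
  have "g \<otimes> z [^] Suc i \<otimes> inv g = (g \<otimes> z [^] i \<otimes> inv g) \<otimes> (g \<otimes> z \<otimes> inv g)"
    using assms by (simp add: m_assoc inv_solve_left)
  with Suc show ?case by simp
qed (use assms in simp)

text \<open>The entry depends only on \<open>g \<otimes> inv k\<close>, which right translation
  preserves, and the substitution \<open>x = k \<otimes> inv l\<close> turns the product of rows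
  \<open>g\<close> and \<open>k\<close> into the autocorrelation of \<open>f\<close> at
  \<open>g \<otimes> inv k\<close>.\<close>

lemma BH_matrix_if_autocorrelation_zero:
  assumes "finite (carrier G)" "h > 0"
    and root: "\<And>x. x \<in> carrier G \<Longrightarrow> f x ^ h = 1"
    and corr: "\<And>g. g \<in> carrier G \<Longrightarrow> g \<noteq> \<one> \<Longrightarrow> (\<Sum>x\<in>carrier G. f (g \<otimes> x) * cnj (f x)) = 0"
  shows "BH_matrix G h (\<lambda>g k. f (g \<otimes> inv k))"
  unfolding BH_matrix_def group_invariant_def
proof (intro conjI ballI)
  fix g k l assume *: "g \<in> carrier G" "k \<in> carrier G" "l \<in> carrier G"
  then have "g \<otimes> l \<otimes> inv (k \<otimes> l) = g \<otimes> inv k"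
    by (simp add: inv_mult_group m_assoc) (simp add: m_assoc[symmetric])
  then show "f (g \<otimes> l \<otimes> inv (k \<otimes> l)) = f (g \<otimes> inv k)" by simp
next
  fix g k assume gk: "g \<in> carrier G" "k \<in> carrier G"
  show "f (g \<otimes> inv k) ^ h = 1" using gk root by simp
  have bij: "bij_betw (\<lambda>l. k \<otimes> inv l) (carrier G) (carrier G)"
    by (rule bij_betw_byWitness[where f' = "\<lambda>x. inv x \<otimes> k"])
       (use gk in \<open>auto simp: inv_mult_group m_assoc\<close>, simp_all add: m_assoc[symmetric])
  have "(\<Sum>l\<in>carrier G. f (g \<otimes> inv l) * cnj (f (k \<otimes> inv l))) =
        (\<Sum>l\<in>carrier G. f ((g \<otimes> inv k) \<otimes> (k \<otimes> inv l)) * cnj (f (k \<otimes> inv l)))"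
  proof (rule sum.cong)
    fix l assume "l \<in> carrier G"
    then have "(g \<otimes> inv k) \<otimes> (k \<otimes> inv l) = g \<otimes> inv l"
      using gk by (simp add: m_assoc) (simp add: m_assoc[symmetric])
    then show "f (g \<otimes> inv l) * cnj (f (k \<otimes> inv l)) =
        f ((g \<otimes> inv k) \<otimes> (k \<otimes> inv l)) * cnj (f (k \<otimes> inv l))" by simp
  qed simp
  also have "\<dots> = (\<Sum>x\<in>carrier G. f ((g \<otimes> inv k) \<otimes> x) * cnj (f x))"
    by (rule sum.reindex_bij_betw[OF bij])
  also have "\<dots> = (if g = k then of_nat (order G) else 0)"
  proof (cases "g = k")
    case True
    have "f x * cnj (f x) = 1" if "x \<in> carrier G" for x
    proof -
      have "norm (f x) = 1" using power_eq_1_iff[OF root[OF that]] \<open>h > 0\<close> by simp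
      then show ?thesis by (simp flip: complex_norm_square)
    qed
    with True gk show ?thesis by (simp add: order_def)
  next
    case False
    then have "g \<otimes> inv k \<noteq> \<one>"
      using gk by (metis inv_closed inv_equality inv_inv)
    with False gk corr show ?thesis by simp
  qed
  finally show "(\<Sum>l\<in>carrier G. f (g \<otimes> inv l) * cnj (f (k \<otimes> inv l))) =
    (if g = k then of_nat (order G) else 0)" .
qed (rule assms)

end

text \<open>\<open>v g\<close> records the action of \<open>g\<close> on \<open>z\<close> by
  conjugation. It is determined only modulo \<open>ord z\<close>, so facts about \<open>v\<close>
  are congruences.\<close>

locale normalized_cyclic = group G for G (structure) +
  fixes z :: 'a and v :: "'a \<Rightarrow> nat"
  assumes finite_carrier: "finite (carrier G)"
    and z_closed [simp]: "z \<in> carrier G"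
    and conj_z: "g \<in> carrier G \<Longrightarrow> g \<otimes> z \<otimes> inv g = z [^] v g"
begin

definition N :: "'a set" where "N = generate G {z}"

lemma N_eq: "N = range (\<lambda>i::nat. z [^] i)"
  unfolding N_def using generate_pow_on_finite_carrier[OF finite_carrier z_closed] by auto

lemma subgroup_N: "subgroup N G"
  unfolding N_def by (rule generate_is_subgroup) simp

lemma N_subset: "N \<subseteq> carrier G"
  by (rule subgroup.subset[OF subgroup_N])

lemma pow_in_N [simp]: "z [^] (i::nat) \<in> N"
  by (auto simp: N_eq)

lemma card_N: "card N = ord z"
  by (simp add: N_def generate_pow_card)

lemma ord_z_pos: "ord z > 0"
  using ord_ge_1[OF finite_carrier z_closed] by simp

lemma mult_pow_z:
  assumes "g \<in> carrier G"
  shows "g \<otimes> z [^] (i::nat) = z [^] (v g * i) \<otimes> g"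
proof -
  have "g \<otimes> z [^] i = (g \<otimes> z [^] i \<otimes> inv g) \<otimes> g"
    using assms by (simp add: m_assoc)
  also have "\<dots> = z [^] (v g * i) \<otimes> g"
    using assms by (simp add: nat_pow_conj conj_z nat_pow_pow)
  finally show ?thesis .
qed

lemma v_cong_iff:
  assumes "g \<in> carrier G"
  shows "[v g = i] (mod ord z) \<longleftrightarrow> g \<otimes> z = z [^] i \<otimes> g"
proof -
  have "g \<otimes> z = z [^] v g \<otimes> g"
    using mult_pow_z[OF assms, of 1] by simp
  then show ?thesis
    using assms by (simp add: nat_pow_eq_iff_cong[symmetric])
qed

lemma v_mult:
  assumes "g \<in> carrier G" "g' \<in> carrier G"
  shows "[v (g \<otimes> g') = v g * v g'] (mod ord z)"
proof -
  have "g \<otimes> g' \<otimes> z = g \<otimes> (z [^] v g' \<otimes> g')"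
    using assms mult_pow_z[of g' 1] by (simp add: m_assoc)
  also have "\<dots> = z [^] (v g * v g') \<otimes> (g \<otimes> g')"
    using assms mult_pow_z[of g "v g'"] by (simp add: m_assoc[symmetric])
  finally show ?thesis
    using assms by (simp add: v_cong_iff)
qed

lemma v_N:
  assumes "g \<in> N"
  shows "[v g = 1] (mod ord z)"
proof -
  obtain i :: nat where "g = z [^] i" using assms by (auto simp: N_eq)
  then show ?thesis
    by (simp add: v_cong_iff nat_pow_comm[of z i 1, simplified])
qed

lemma v_inv:
  assumes "g \<in> carrier G"
  shows "[v g * v (inv g) = 1] (mod ord z)"
  using v_mult[of g "inv g"] v_N[OF subgroup.one_closed[OF subgroup_N]] assms
  by simp (meson cong_sym cong_trans)

lemma coprime_v:
  assumes "g \<in> carrier G"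
  shows "coprime (v g) (ord z)"
  using v_inv[OF assms] coprime_iff_invertible_nat by auto

text \<open>\<open>v\<close> is multiplicative and 1 on \<open>N\<close>, so it descends to right
  cosets; modulo \<open>ord z\<close> the choice of representative does not matter.\<close>

lemma v_rcoset:
  assumes "x \<in> carrier G" "y \<in> N #> x"
  shows "[v y = v x] (mod ord z)"
proof -
  obtain g where g: "g \<in> N" "y = g \<otimes> x" using assms(2) by (auto simp: r_coset_def)
  then have "[v y = v g * v x] (mod ord z)"
    using v_mult assms(1) N_subset by auto
  also have "[v g * v x = 1 * v x] (mod ord z)"
    using v_N[OF g(1)] by (intro cong_mult) auto
  finally show ?thesis by simp
qed

section \<open>Right cosets of \<open>N\<close> and their labels\<close>

definition rep :: "'a set \<Rightarrow> 'a" where "rep C = (SOME x. x \<in> C)"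

lemma rep_in_rcoset:
  assumes "x \<in> carrier G"
  shows "rep (N #> x) \<in> N #> x"
  unfolding rep_def by (rule someI, rule rcos_self[OF assms subgroup_N])

lemma rcoset_subset: "x \<in> carrier G \<Longrightarrow> N #> x \<subseteq> carrier G"
  by (rule r_coset_subset_G[OF N_subset])

lemma rep_closed [simp]: "x \<in> carrier G \<Longrightarrow> rep (N #> x) \<in> carrier G"
  using rep_in_rcoset rcoset_subset by blast

lemma rcoset_eq:
  assumes "x \<in> carrier G" "y \<in> N #> x"
  shows "N #> y = N #> x"
  using repr_independence[OF assms(2,1) subgroup_N] by simp

lemma rcoset_pow_mult [simp]:
  assumes "x \<in> carrier G"
  shows "N #> (z [^] (i::nat) \<otimes> x) = N #> x"
  by (rule rcoset_eq[OF assms], rule rcosI) (use assms N_subset in auto)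

lemma rcoset_mult_eq_iff:
  assumes "g \<in> carrier G" "x \<in> carrier G"
  shows "N #> (g \<otimes> x) = N #> x \<longleftrightarrow> g \<in> N"
proof
  assume "N #> (g \<otimes> x) = N #> x"
  then have "g \<otimes> x \<in> N #> x"
    using rcos_self[OF _ subgroup_N, of "g \<otimes> x"] assms by simp
  then show "g \<in> N"
    using assms N_subset by (auto simp: r_coset_def dest: subsetD)
next
  assume "g \<in> N"
  then obtain i :: nat where "g = z [^] i" unfolding N_eq by blast
  then show "N #> (g \<otimes> x) = N #> x"
    using assms by simp
qed

definition u :: "'a set \<Rightarrow> nat" where "u C = v (rep C)"

lemma u_rcoset: "x \<in> carrier G \<Longrightarrow> [u (N #> x) = v x] (mod ord z)"
  unfolding u_def by (intro v_rcoset rep_in_rcoset)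

text \<open>Right multiplication by \<open>inv x \<otimes> y\<close> permutes the cosets and
  multiplies \<open>v\<close> by a fixed unit, sending the fibre of \<open>x\<close> into that of
  \<open>y\<close>. Exchanging \<open>x\<close> and \<open>y\<close> gives equality.\<close>

lemma card_fibre_le:
  assumes "d dvd ord z" "x \<in> carrier G" "y \<in> carrier G"
  shows "card {C \<in> rcosets N. [u C = u (N #> x)] (mod d)} \<le>
    card {C \<in> rcosets N. [u C = u (N #> y)] (mod d)}"
proof (rule card_inj_on_le)
  let ?g = "inv x \<otimes> y"
  show "inj_on (\<lambda>C. C #> ?g) {C \<in> rcosets N. [u C = u (N #> x)] (mod d)}"
  proof (rule inj_on_inverseI[where g = "\<lambda>C. C #> inv ?g"])
    fix C assume "C \<in> {C \<in> rcosets N. [u C = u (N #> x)] (mod d)}"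
    then have "C \<subseteq> carrier G"
      using rcosets_subset_PowG[OF subgroup_N] by auto
    then show "C #> ?g #> inv ?g = C"
      using assms by (simp add: coset_mult_assoc)
  qed
  show "(\<lambda>C. C #> ?g) ` {C \<in> rcosets N. [u C = u (N #> x)] (mod d)}
    \<subseteq> {C \<in> rcosets N. [u C = u (N #> y)] (mod d)}"
  proof safe
    fix C assume C: "C \<in> rcosets N" "[u C = u (N #> x)] (mod d)"
    then obtain c where c: "c \<in> carrier G" "C = N #> c" by (auto simp: RCOSETS_def)
    then have Cg: "C #> ?g = N #> (c \<otimes> ?g)"
      using assms N_subset by (simp add: coset_mult_assoc)
    then show "C #> ?g \<in> rcosets N"
      using c assms N_subset by (auto intro!: rcosetsI)
    have uv: "[u (N #> w) = v w] (mod d)" if "w \<in> carrier G" for w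
      using u_rcoset[OF that] assms(1) by (rule cong_dvd_modulus_nat)
    have vm: "[v (w \<otimes> w') = v w * v w'] (mod d)" if "w \<in> carrier G" "w' \<in> carrier G" for w w'
      using v_mult[OF that] assms(1) by (rule cong_dvd_modulus_nat)
    have "[v c = u C] (mod d)" using uv[OF c(1)] c(2) by (simp add: cong_sym)
    also note C(2)
    also have "[u (N #> x) = v x] (mod d)" using uv assms by simp
    finally have cx: "[v c = v x] (mod d)" .
    have "[u (C #> ?g) = v (c \<otimes> ?g)] (mod d)" unfolding Cg using c assms by (intro uv) simp
    also have "[v (c \<otimes> ?g) = v c * v ?g] (mod d)" using c assms by (intro vm) auto
    also have "[v c * v ?g = v x * v ?g] (mod d)" using cx by (intro cong_mult) auto
    also have "[v x * v ?g = v (x \<otimes> ?g)] (mod d)" using vm[of x ?g] assms by (simp add: cong_sym)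
    also have "x \<otimes> ?g = y" using assms by (simp add: m_assoc[symmetric])
    also have "[v y = u (N #> y)] (mod d)" using uv assms by (simp add: cong_sym)
    finally show "[u (C #> ?g) = u (N #> y)] (mod d)" .
  qed
  show "finite {C \<in> rcosets N. [u C = u (N #> y)] (mod d)}"
    using finite_carrier by (simp add: RCOSETS_def)
qed

text \<open>As \<open>k dvd ord z\<close>, the values of \<open>v\<close> are units modulo
  \<open>k\<close>, and translation makes their fibres equal in size modulo each divisor of
  \<open>k\<close>.\<close>

lemma rcoset_labelling_exists:
  assumes "order G = k * ord z" "k dvd ord z"
  obtains a :: "'a set \<Rightarrow> nat" where
    "\<And>x y. x \<in> carrier G \<Longrightarrow> y \<in> carrier G \<Longrightarrow> [a (N #> x) = a (N #> y)] (mod k) \<Longrightarrow> N #> x = N #> y"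
    "\<And>x y. x \<in> carrier G \<Longrightarrow> y \<in> carrier G \<Longrightarrow>
      [a (N #> x) * v x = a (N #> y) * v y] (mod k) \<Longrightarrow> N #> x = N #> y"
proof -
  have "k > 0" using assms(2) ord_z_pos by (metis dvd_pos_nat)
  have "card (rcosets N) = k"
    using lagrange[OF subgroup_N] assms(1) ord_z_pos by (simp add: card_N)
  have "\<exists>a. twisted_labelling (rcosets N) u k a"
  proof (rule twisted_labelling_exists)
    show "finite (rcosets N)" using finite_carrier by (auto simp: RCOSETS_def)
    show "coprime (u C) k" if "C \<in> rcosets N" for C
    proof -
      have "coprime (u C) (ord z)"
        using that by (auto simp: RCOSETS_def u_def intro!: coprime_v)
      then show ?thesis using assms(2) by (metis coprime_divisors dvd_refl)
    qed
    show "equidistributed_mod (rcosets N) u d" if "d dvd k" for d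
    proof -
      have d: "d dvd ord z" using that assms(2) by (rule dvd_trans)
      have "card {C \<in> rcosets N. [u C = u C'] (mod d)} =
          card {C \<in> rcosets N. [u C = u (N #> \<one>)] (mod d)}" if C': "C' \<in> rcosets N" for C'
      proof -
        obtain x where x: "x \<in> carrier G" "C' = N #> x" using C' by (auto simp: RCOSETS_def)
        show ?thesis
          unfolding x(2) by (intro antisym card_fibre_le d x(1)) simp_all
      qed
      then show ?thesis unfolding equidistributed_mod_def by blast
    qed
  qed fact+
  then obtain a where a: "twisted_labelling (rcosets N) u k a" ..
  have R: "N #> x \<in> rcosets N" if "x \<in> carrier G" for x
    using that N_subset by (rule rcosetsI[rotated])
  show thesis
  proof (rule that)
    fix x y assume xy: "x \<in> carrier G" "y \<in> carrier G"
    show "N #> x = N #> y" if "[a (N #> x) = a (N #> y)] (mod k)"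
      using a R[OF xy(1)] R[OF xy(2)] that unfolding twisted_labelling_def by blast
    show "N #> x = N #> y" if c: "[a (N #> x) * v x = a (N #> y) * v y] (mod k)"
    proof -
      have uv: "[u (N #> w) = v w] (mod k)" if "w \<in> carrier G" for w
        using u_rcoset[OF that] assms(2) by (rule cong_dvd_modulus_nat)
      have "[a (N #> x) * u (N #> x) = a (N #> x) * v x] (mod k)"
        using uv xy by (intro cong_mult) auto
      also note c
      also have "[a (N #> y) * v y = a (N #> y) * u (N #> y)] (mod k)"
        using uv[OF xy(2)] by (intro cong_mult) (auto simp: cong_sym)
      finally show ?thesis
        using a R[OF xy(1)] R[OF xy(2)] unfolding twisted_labelling_def by blast
    qed
  qed
qed

end

subsection \<open>The construction\<close>

text \<open>\<open>A\<close> is the coefficient of the quadratic phase: \<open>j \<mapsto> \<omega> ^ (A * j\<^sup>2)\<close> has period \<open>m\<close>, and its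
  autocorrelation vanishes except at multiples of \<open>m\<close>.\<close>

locale butson_function = normalized_cyclic G z v for G (structure) and z v +
  fixes k m H A :: nat and a :: "'a set \<Rightarrow> nat"
  assumes ord_z: "ord z = k * m" and order_G: "order G = k * ord z"
    and H_pos: "H > 0" and dvd_H: "ord z dvd H"
    and A_periodic: "H dvd 2 * A * m" "H dvd A * m\<^sup>2"
    and A_perfect: "H dvd 2 * A * s \<Longrightarrow> m dvd s"
    and a_inj: "x \<in> carrier G \<Longrightarrow> y \<in> carrier G \<Longrightarrow>
      [a (N #> x) = a (N #> y)] (mod k) \<Longrightarrow> N #> x = N #> y"
    and av_inj: "x \<in> carrier G \<Longrightarrow> y \<in> carrier G \<Longrightarrow>
      [a (N #> x) * v x = a (N #> y) * v y] (mod k) \<Longrightarrow> N #> x = N #> y"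
begin

abbreviation \<omega> :: complex where "\<omega> \<equiv> root_of_unity H"

text \<open>\<open>\<omega> ^ B\<close> is a primitive root of unity of order \<open>ord z\<close>,
  so its powers give the characters of \<open>N\<close>.\<close>

definition B :: nat where "B = H div ord z"

text \<open>The exponent of \<open>z\<close> when \<open>x\<close> is written through its coset
  representative; only its residue modulo \<open>ord z\<close> is determined, which is all that
  \<open>f\<close> sees.\<close>

definition J :: "'a \<Rightarrow> nat" where
  "J x = (SOME i. x = z [^] i \<otimes> rep (N #> x))"

definition f :: "'a \<Rightarrow> complex" where
  "f x = \<omega> ^ (B * a (N #> x) * J x + A * (J x)\<^sup>2)"

lemma B_eq: "B * (k * m) = H"
  using dvd_H by (simp add: B_def ord_z)

lemma pos: "k > 0" "m > 0" "B > 0"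
  using B_eq H_pos by (metis mult_is_0 not_gr_zero)+

lemma J_eq:
  assumes "x \<in> carrier G"
  shows "x = z [^] J x \<otimes> rep (N #> x)"
  unfolding J_def
proof (rule someI_ex)
  have "x \<in> N #> rep (N #> x)"
    using rcoset_eq[OF assms rep_in_rcoset[OF assms]] rcos_self[OF assms subgroup_N] by simp
  then show "\<exists>i::nat. x = z [^] i \<otimes> rep (N #> x)"
    by (auto simp: r_coset_def N_eq)
qed

lemma J_pow_mult:
  assumes "x \<in> carrier G"
  shows "[J (z [^] (i::nat) \<otimes> x) = J x + i] (mod ord z)"
proof -
  have "z [^] J (z [^] i \<otimes> x) \<otimes> rep (N #> x) = z [^] i \<otimes> x"
    using J_eq[of "z [^] i \<otimes> x"] assms by simp
  also have "\<dots> = z [^] i \<otimes> (z [^] J x \<otimes> rep (N #> x))"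
    using J_eq[OF assms] by simp
  also have "\<dots> = z [^] (J x + i) \<otimes> rep (N #> x)"
    using assms by (simp add: m_assoc[symmetric] nat_pow_mult add.commute)
  finally show ?thesis
    using assms by (simp add: nat_pow_eq_iff_cong[symmetric])
qed

text \<open>Expanding the square leaves a term divisible by \<open>2 * A * m\<close> and one
  divisible by \<open>A * m\<^sup>2\<close>, both multiples of \<open>H\<close>.\<close>

lemma quadratic_periodic: "[A * (j + m * s)\<^sup>2 = A * j\<^sup>2] (mod H)"
proof -
  have "[A * j\<^sup>2 + (2 * A * m * (j * s) + A * m\<^sup>2 * s\<^sup>2) = A * j\<^sup>2 + 0] (mod H)"
    using A_periodic by (intro cong_add) (auto simp: cong_0_iff)
  moreover have "A * (j + m * s)\<^sup>2 = A * j\<^sup>2 + (2 * A * m * (j * s) + A * m\<^sup>2 * s\<^sup>2)"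
    by (simp add: power2_eq_square algebra_simps)
  ultimately show ?thesis by simp
qed

text \<open>This frees \<open>f\<close> from the choice of exponent: \<open>B * ord z = H\<close>
  handles the linear part, and \<open>m dvd ord z\<close> the quadratic part.\<close>

lemma exponent_cong:
  assumes "[i = j] (mod ord z)"
  shows "[B * c * i + A * i\<^sup>2 = B * c * j + A * j\<^sup>2] (mod H)"
proof (rule cong_add)
  have "[B * i = B * j] (mod B * ord z)"
    using assms by (simp add: cong_def flip: mult_mod_right)
  then have "[B * i = B * j] (mod H)" using B_eq by (simp add: ord_z)
  then have "[c * (B * i) = c * (B * j)] (mod H)" by (rule cong_mult[OF cong_refl])
  then show "[B * c * i = B * c * j] (mod H)" by (simp add: ac_simps)
  have q: "[A * (r + ord z * s)\<^sup>2 = A * r\<^sup>2] (mod H)" for r s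
    using quadratic_periodic[of r "k * s"] by (simp add: ord_z ac_simps)
  have "[A * i\<^sup>2 = A * (i mod ord z)\<^sup>2] (mod H)" for i
    using q[of "i mod ord z" "i div ord z"] by simp
  then show "[A * i\<^sup>2 = A * j\<^sup>2] (mod H)"
    using assms unfolding cong_def by metis
qed

lemma f_pow_mult:
  assumes "x \<in> carrier G"
  shows "f (z [^] (i::nat) \<otimes> x) = \<omega> ^ (B * a (N #> x) * (J x + i) + A * (J x + i)\<^sup>2)"
  using exponent_cong[OF J_pow_mult[OF assms]] assms H_pos
  by (simp add: f_def root_of_unity_pow_eq_iff)

text \<open>Only the character reacts to a shift by a multiple of \<open>m\<close>. As
  \<open>B * m * k = H\<close>, the factor is a power of the primitive \<open>k\<close>-th root of
  unity \<open>\<omega> ^ (B * m)\<close>.\<close>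

lemma f_pow_m_mult:
  assumes "x \<in> carrier G"
  shows "f (z [^] (m * i) \<otimes> x) = \<omega> ^ (B * m * a (N #> x) * i) * f x"
proof -
  have "[B * a (N #> x) * (J x + m * i) + A * (J x + m * i)\<^sup>2 =
      B * a (N #> x) * (J x + m * i) + A * (J x)\<^sup>2] (mod H)"
    by (intro cong_add quadratic_periodic) auto
  then have "f (z [^] (m * i) \<otimes> x) = \<omega> ^ (B * a (N #> x) * (J x + m * i) + A * (J x)\<^sup>2)"
    using assms H_pos by (simp add: f_pow_mult root_of_unity_pow_eq_iff)
  also have "\<dots> = \<omega> ^ (B * m * a (N #> x) * i) * f x"
    by (simp add: f_def algebra_simps flip: power_add)
  finally show ?thesis .
qed

lemma sum_translate:
  assumes "c \<in> carrier G"
  shows "(\<Sum>x\<in>carrier G. t (c \<otimes> x)) = (\<Sum>x\<in>carrier G. t x)"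
proof (rule sum.reindex_bij_betw)
  show "bij_betw ((\<otimes>) c) (carrier G) (carrier G)"
    by (rule bij_betw_byWitness[where f' = "\<lambda>x. inv c \<otimes> x"])
       (use assms in \<open>auto simp: m_assoc[symmetric]\<close>)
qed

lemma f_root: "f x ^ H = 1"
  using H_pos by (simp add: f_def root_of_unity_pow_eq_1_iff flip: power_mult)

text \<open>Translating by powers of \<open>z [^] m\<close> leaves the quadratic factor unchanged and multiplies the
  summand by a nontrivial \<open>k\<close>-th root of unity.\<close>

lemma correlation_outside:
  assumes "g \<in> carrier G" "g \<notin> N"
  shows "(\<Sum>x\<in>carrier G. f (g \<otimes> x) * cnj (f x)) = 0"
proof -
  define t where "t x = f (g \<otimes> x) * cnj (f x)" for x
  have zero: "(\<Sum>i<k. t (z [^] (m * i) \<otimes> x)) = 0" if x: "x \<in> carrier G" for x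
  proof -
    \<comment> \<open>Moving \<open>g\<close> past \<open>z [^] (m * i)\<close> multiplies the
      exponent by \<open>v g\<close>, which is why \<open>v g\<close> enters \<open>e1\<close>
      only.\<close>
    define e1 e2 where "e1 = B * m * a (N #> (g \<otimes> x)) * v g" and "e2 = B * m * a (N #> x)"
    define \<rho> where "\<rho> = \<omega> ^ e1 * cnj (\<omega> ^ e2)"
    have t: "t (z [^] (m * i) \<otimes> x) = t x * \<rho> ^ i" for i
    proof -
      have "g \<otimes> (z [^] (m * i) \<otimes> x) = z [^] (m * (v g * i)) \<otimes> (g \<otimes> x)"
        using mult_pow_z[OF assms(1), of "m * i"] assms(1) x
        by (simp add: m_assoc[symmetric] mult.left_commute)
      moreover have "f (z [^] (m * (v g * i)) \<otimes> (g \<otimes> x)) = \<omega> ^ (e1 * i) * f (g \<otimes> x)"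
        using f_pow_m_mult[of "g \<otimes> x" "v g * i"] assms(1) x by (simp add: e1_def mult.assoc)
      moreover have "f (z [^] (m * i) \<otimes> x) = \<omega> ^ (e2 * i) * f x"
        using f_pow_m_mult[OF x] by (simp add: e2_def)
      ultimately have "t (z [^] (m * i) \<otimes> x) =
          (\<omega> ^ (e1 * i) * f (g \<otimes> x)) * cnj (\<omega> ^ (e2 * i) * f x)"
        by (simp add: t_def)
      also have "\<dots> = t x * ((\<omega> ^ e1) ^ i * cnj (\<omega> ^ e2) ^ i)"
        by (simp only: t_def power_mult complex_cnj_mult complex_cnj_power mult_ac)
      finally show ?thesis by (simp only: \<rho>_def power_mult_distrib)
    qed
    have "\<rho> ^ k = 1"
    proof -
      have "e1 * k = B * (k * m) * (a (N #> (g \<otimes> x)) * v g)" "e2 * k = B * (k * m) * a (N #> x)"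
        by (simp_all add: e1_def e2_def)
      then have "H dvd e1 * k" "H dvd e2 * k"
        unfolding B_eq by simp_all
      then have "\<omega> ^ (e1 * k) = 1" "\<omega> ^ (e2 * k) = 1"
        using H_pos by (simp_all add: root_of_unity_pow_eq_1_iff)
      then show ?thesis
        by (simp add: \<rho>_def power_mult_distrib power_mult flip: complex_cnj_power)
    qed
    moreover have "\<rho> \<noteq> 1"
    proof
      assume "\<rho> = 1"
      have "\<omega> ^ e1 = \<rho> * \<omega> ^ e2"
        using root_of_unity_mult_cnj[of H e2]
        by (simp only: \<rho>_def mult.assoc mult.commute[of "cnj _"] mult_1_right)
      with \<open>\<rho> = 1\<close> have "[e1 = e2] (mod H)"
        using H_pos by (simp add: root_of_unity_pow_eq_iff)
      \<comment> \<open>Cancelling \<open>B * m\<close> leaves a congruence modulo \<open>k\<close>;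
        multiplying by \<open>v x\<close> turns it into the products that \<open>av_inj\<close>
        separates.\<close>
      then have "[(B * m) * (a (N #> (g \<otimes> x)) * v g) = (B * m) * a (N #> x)] (mod (B * m) * k)"
        using B_eq by (simp add: e1_def e2_def ac_simps)
      then have "[a (N #> (g \<otimes> x)) * v g = a (N #> x)] (mod k)"
        using pos by (simp add: cong_def flip: mult_mod_right)
      then have "[a (N #> (g \<otimes> x)) * v g * v x = a (N #> x) * v x] (mod k)"
        by (intro cong_mult) auto
      moreover have "[v (g \<otimes> x) = v g * v x] (mod k)"
        using v_mult[OF assms(1) x] by (rule cong_dvd_modulus_nat) (simp add: ord_z)
      then have "[a (N #> (g \<otimes> x)) * v (g \<otimes> x) = a (N #> (g \<otimes> x)) * (v g * v x)] (mod k)"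
        by (intro cong_mult) auto
      ultimately have "[a (N #> (g \<otimes> x)) * v (g \<otimes> x) = a (N #> x) * v x] (mod k)"
        by (metis cong_trans mult.assoc)
      then have "N #> (g \<otimes> x) = N #> x"
        using av_inj assms(1) x by simp
      with assms x show False by (simp add: rcoset_mult_eq_iff)
    qed
    ultimately show ?thesis
      by (simp add: t sum_powers_eq_0 flip: sum_distrib_left)
  qed
  have "of_nat k * (\<Sum>x\<in>carrier G. t x) = (\<Sum>i<k. \<Sum>x\<in>carrier G. t (z [^] (m * i) \<otimes> x))"
    by (simp add: sum_translate)
  also have "\<dots> = (\<Sum>x\<in>carrier G. \<Sum>i<k. t (z [^] (m * i) \<otimes> x))"
    by (rule sum.swap)
  also have "\<dots> = 0" using zero by simp
  finally show ?thesis using pos by (simp add: t_def)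
qed

lemma card_rcosets: "card (rcosets N) = k"
  using lagrange[OF subgroup_N] order_G ord_z_pos by (simp add: card_N)

text \<open>An injection of \<open>k\<close> cosets into \<open>k\<close> residues is onto, so sums
  over labels become full geometric sums.\<close>

lemma bij_betw_a: "bij_betw (\<lambda>C. a C mod k) (rcosets N) {..<k}"
proof -
  have inj: "inj_on (\<lambda>C. a C mod k) (rcosets N)"
    using a_inj by (auto simp: inj_on_def RCOSETS_def cong_def)
  moreover have "(\<lambda>C. a C mod k) ` (rcosets N) = {..<k}"
    by (rule card_subset_eq) (use pos inj in \<open>auto simp: card_image card_rcosets\<close>)
  ultimately show ?thesis by (simp add: bij_betw_def)
qed

text \<open>If \<open>m\<close> does not divide \<open>s\<close>, translating by \<open>z\<close>
  multiplies the sum by a root of unity other than 1, by \<open>A_perfect\<close>. If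
  \<open>m\<close> divides \<open>s\<close>, the quadratic phase drops out, the summand is constant
  on each coset, and the labels produce a full geometric sum.\<close>

lemma correlation_pow:
  assumes "z [^] (s::nat) \<noteq> \<one>"
  shows "(\<Sum>x\<in>carrier G. f (z [^] s \<otimes> x) * cnj (f x)) = 0"
proof -
  define t where "t x = f (z [^] s \<otimes> x) * cnj (f x)" for x
  \<comment> \<open>The character leaves \<open>B * a (N #> x) * s\<close>, and the difference of
    squares leaves \<open>2 * (J x + i) * s + s\<^sup>2\<close>, linear in \<open>i\<close>.\<close>
  have t: "t (z [^] (i::nat) \<otimes> x) = \<omega> ^ (B * a (N #> x) * s + A * (2 * (J x + i) * s + s\<^sup>2))"
    if x: "x \<in> carrier G" for x i
  proof -
    have "z [^] s \<otimes> (z [^] i \<otimes> x) = z [^] (i + s) \<otimes> x"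
      using x by (simp add: m_assoc[symmetric] nat_pow_mult add.commute)
    then have "t (z [^] i \<otimes> x) = \<omega> ^ (B * a (N #> x) * (J x + (i + s)) + A * (J x + (i + s))\<^sup>2) *
        cnj (\<omega> ^ (B * a (N #> x) * (J x + i) + A * (J x + i)\<^sup>2))"
      using x by (simp only: t_def f_pow_mult)
    also have "B * a (N #> x) * (J x + (i + s)) + A * (J x + (i + s))\<^sup>2 =
        (B * a (N #> x) * s + A * (2 * (J x + i) * s + s\<^sup>2)) +
        (B * a (N #> x) * (J x + i) + A * (J x + i)\<^sup>2)"
      by (simp add: power2_eq_square algebra_simps)
    finally show ?thesis
      by (simp only: root_of_unity_add_mult_cnj)
  qed
  have "(\<Sum>x\<in>carrier G. t x) = 0"
  proof (cases "m dvd s")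
    case False
    define \<rho> where "\<rho> = \<omega> ^ (2 * A * s)"
    have "\<rho> \<noteq> 1"
      using False A_perfect H_pos by (auto simp: \<rho>_def root_of_unity_pow_eq_1_iff)
    have "(\<Sum>x\<in>carrier G. t x) = (\<Sum>x\<in>carrier G. t (z [^] (1::nat) \<otimes> x))"
      using sum_translate[of "z [^] (1::nat)" t] by simp
    also have "\<dots> = (\<Sum>x\<in>carrier G. \<rho> * t (z [^] (0::nat) \<otimes> x))"
      by (rule sum.cong) (simp_all only: t \<rho>_def power_add[symmetric], simp add: algebra_simps)
    also have "\<dots> = \<rho> * (\<Sum>x\<in>carrier G. t x)"
      by (simp add: sum_distrib_left)
    finally show ?thesis using \<open>\<rho> \<noteq> 1\<close> by simp
  next
    case True
    then obtain s' where s': "s = m * s'" ..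
    define \<rho> where "\<rho> = \<omega> ^ (B * s)"
    have tx: "t x = \<rho> ^ (a C mod k)" if C: "C \<in> rcosets N" "x \<in> C" for x C
    proof -
      obtain y where y: "y \<in> carrier G" "C = N #> y" using C by (auto simp: RCOSETS_def)
      then have x: "x \<in> carrier G" "N #> x = C"
        using C(2) rcoset_subset[OF y(1)] rcoset_eq[OF y(1)] by blast+
      have "H dvd A * (2 * J x * s + s\<^sup>2)"
      proof -
        have "A * (2 * J x * s + s\<^sup>2) = 2 * A * m * (J x * s') + A * m\<^sup>2 * s'\<^sup>2"
          by (simp add: s' power2_eq_square algebra_simps)
        then show ?thesis using A_periodic by simp
      qed
      then have "\<omega> ^ (A * (2 * J x * s + s\<^sup>2)) = 1"
        using H_pos by (simp add: root_of_unity_pow_eq_1_iff)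
      with t[OF x(1), of 0] x have "t x = \<omega> ^ (B * s * a C)"
        by (simp add: power_add ac_simps)
      moreover have "[B * s * a C = B * s * (a C mod k)] (mod H)"
      proof -
        have "[a C = a C mod k] (mod k)" by (simp add: cong_def)
        then have "[(B * m) * a C = (B * m) * (a C mod k)] (mod (B * m) * k)"
          using pos by (simp add: cong_def flip: mult_mod_right)
        then have "[s' * ((B * m) * a C) = s' * ((B * m) * (a C mod k))] (mod (B * m) * k)"
          by (rule cong_mult[OF cong_refl])
        then show ?thesis
          using B_eq by (simp add: s' ac_simps)
      qed
      ultimately show ?thesis
        using H_pos by (simp add: \<rho>_def root_of_unity_pow_eq_iff flip: power_mult)
    qed
    have "(\<Sum>x\<in>carrier G. t x) = (\<Sum>C\<in>rcosets N. \<Sum>x\<in>C. t x)"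
    proof -
      have "(\<Sum>x\<in>\<Union>(rcosets N). t x) = (\<Sum>C\<in>rcosets N. \<Sum>x\<in>C. t x)"
      proof (rule sum.Union_disjoint[unfolded comp_def])
        show "\<forall>C\<in>rcosets N. finite C"
          using rcosets_finite[OF _ N_subset] finite_subset[OF N_subset finite_carrier] by auto
        show "\<forall>C\<in>rcosets N. \<forall>D\<in>rcosets N. C \<noteq> D \<longrightarrow> C \<inter> D = {}"
          using rcos_disjoint[OF subgroup_N] by (auto simp: pairwise_def disjnt_def)
      qed
      then show ?thesis by (simp add: rcosets_part_G[OF subgroup_N])
    qed
    also have "\<dots> = (\<Sum>C\<in>rcosets N. of_nat (ord z) * \<rho> ^ (a C mod k))"
    proof (rule sum.cong)
      fix C assume C: "C \<in> rcosets N"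
      then have "card C = ord z"
        using card_rcosets_equal[OF C N_subset] card_N by simp
      then show "(\<Sum>x\<in>C. t x) = of_nat (ord z) * \<rho> ^ (a C mod k)"
        using tx[OF C] by simp
    qed simp
    also have "\<dots> = of_nat (ord z) * (\<Sum>i<k. \<rho> ^ i)"
      using sum.reindex_bij_betw[OF bij_betw_a, of "\<lambda>i. \<rho> ^ i"] by (simp flip: sum_distrib_left)
    also have "(\<Sum>i<k. \<rho> ^ i) = 0"
    proof (rule sum_powers_eq_0)
      have "B * s * k = B * (k * m) * s'" by (simp add: s')
      then have "H dvd B * s * k" unfolding B_eq by simp
      then show "\<rho> ^ k = 1"
        using H_pos by (simp add: \<rho>_def root_of_unity_pow_eq_1_iff flip: power_mult)
      show "\<rho> \<noteq> 1"
      proof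
        assume "\<rho> = 1"
        then have "B * (k * m) dvd B * s"
          using H_pos by (simp add: \<rho>_def root_of_unity_pow_eq_1_iff B_eq)
        then have "ord z dvd s" using pos by (simp add: ord_z)
        with assms show False by (simp add: pow_eq_id)
      qed
    qed
    finally show ?thesis by simp
  qed
  then show ?thesis by (simp add: t_def)
qed

lemma BH_matrix_f: "BH_matrix G H (\<lambda>g k. f (g \<otimes> inv k))"
proof (rule BH_matrix_if_autocorrelation_zero[OF finite_carrier H_pos f_root])
  fix g assume "g \<in> carrier G" "g \<noteq> \<one>"
  then show "(\<Sum>x\<in>carrier G. f (g \<otimes> x) * cnj (f x)) = 0"
    using correlation_outside correlation_pow by (cases "g \<in> N") (auto simp: N_eq)
qed

end

text \<open>What remains is a coefficient \<open>A\<close>. For odd \<open>m\<close> the number 2 is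
  invertible modulo \<open>m\<close> and \<open>H / m\<close> works; for even \<open>m\<close> a
  further factor 2 has to be divided out of \<open>H\<close>, whence
  \<open>2 * m dvd H\<close>.\<close>

lemma (in group) BH_matrix_exists_if_normalized_cyclic:
  assumes "finite (carrier G)" and z: "z \<in> carrier G"
    and conj: "\<And>g. g \<in> carrier G \<Longrightarrow> g \<otimes> z \<otimes> inv g \<in> generate G {z}"
    and "order G = k * ord z" and ord_z: "ord z = k * m"
    and "H > 0" "ord z dvd H" and H_even: "even m \<Longrightarrow> 2 * m dvd H"
  shows "\<exists>M. BH_matrix G H M"
proof -
  have "\<exists>i::nat. g \<otimes> z \<otimes> inv g = z [^] i" if "g \<in> carrier G" for g
    using conj[OF that] generate_pow_on_finite_carrier[OF assms(1) z] by auto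
  then obtain v :: "'a \<Rightarrow> nat" where v: "\<And>g. g \<in> carrier G \<Longrightarrow> g \<otimes> z \<otimes> inv g = z [^] v g"
    by metis
  interpret normalized_cyclic G z v
    by unfold_locales (use assms v in auto)
  obtain a where a:
    "\<And>x y. x \<in> carrier G \<Longrightarrow> y \<in> carrier G \<Longrightarrow> [a (N #> x) = a (N #> y)] (mod k) \<Longrightarrow> N #> x = N #> y"
    "\<And>x y. x \<in> carrier G \<Longrightarrow> y \<in> carrier G \<Longrightarrow>
      [a (N #> x) * v x = a (N #> y) * v y] (mod k) \<Longrightarrow> N #> x = N #> y"
    by (rule rcoset_labelling_exists[OF assms(4)]) (auto simp: ord_z)
  have "m dvd H" using \<open>ord z dvd H\<close> by (simp add: ord_z dvd_mult_right)
  obtain A where A: "H dvd 2 * A * m" "H dvd A * m\<^sup>2" "\<And>s. H dvd 2 * A * s \<Longrightarrow> m dvd s"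
  proof (cases "even m")
    case True
    then obtain m' where m: "m = 2 * m'" ..
    \<comment> \<open>\<open>A = H / (2 * m)\<close>; evenness of \<open>m\<close> is what makes
      \<open>A * m\<^sup>2\<close> a multiple of \<open>H\<close>.\<close>
    obtain A where H: "H = 2 * m * A" using H_even[OF True] ..
    show thesis
    proof (rule that)
      have "A * m\<^sup>2 = H * m'" by (simp add: H m power2_eq_square)
      then show "H dvd A * m\<^sup>2" by simp
      show "m dvd s" if "H dvd 2 * A * s" for s
      proof -
        have "(2 * A) * m dvd (2 * A) * s" using that by (simp add: H ac_simps)
        with \<open>H > 0\<close> show ?thesis unfolding H by simp
      qed
    qed (simp add: H)
  next
    case False
    obtain A where H: "H = m * A" using \<open>m dvd H\<close> ..
    show thesis
    proof (rule that)
      show "m dvd s" if "H dvd 2 * A * s" for s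
      proof -
        have "A * m dvd A * (2 * s)" using that by (simp add: H ac_simps)
        with \<open>H > 0\<close> have "m dvd 2 * s" unfolding H by simp
        with False show ?thesis by (simp add: coprime_dvd_mult_right_iff)
      qed
    qed (simp_all add: H power2_eq_square)
  qed
  interpret butson_function G z v k m H A a
    by unfold_locales (use assms A a in auto)
  show ?thesis using BH_matrix_f by blast
qed

section \<open>Arithmetic of the parameters and the cyclic generator\<close>

lemma multiplicity_2_eq_1_iff:
  fixes n :: nat
  assumes "n > 0"
  shows "multiplicity 2 n = 1 \<longleftrightarrow> even n \<and> \<not> 4 dvd n"
proof -
  have pow: "2 ^ j dvd n \<longleftrightarrow> j \<le> multiplicity 2 n" for j
    using assms by (intro power_dvd_iff_le_multiplicity) auto
  have "multiplicity 2 n = 1 \<longleftrightarrow> 1 \<le> multiplicity 2 n \<and> \<not> 2 \<le> multiplicity 2 n" by auto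
  also have "\<dots> \<longleftrightarrow> 2 ^ 1 dvd n \<and> \<not> 2 ^ 2 dvd n"
    by (simp only: pow)
  finally show ?thesis by simp
qed

lemma (in group) iso_integer_mod_group_generator:
  assumes "subgroup N G" "G\<lparr>carrier := N\<rparr> \<cong> integer_mod_group d" "d > 0"
  obtains z where "z \<in> carrier G" "generate G {z} = N" "ord z = d"
proof -
  let ?Z = "integer_mod_group d" and ?N = "G\<lparr>carrier := N\<rparr>"
  note G_generate = generate_pow generate_subgroup_incl generate_pow_card
  have grpN: "group ?N" using assms(1) by (rule subgroup_imp_group)
  then have "?Z \<cong> ?N" using assms(2) by (rule group.iso_sym)
  then obtain \<psi> where \<psi>: "\<psi> \<in> iso ?Z ?N" by (auto simp: is_iso_def)
  interpret group_hom ?Z ?N \<psi>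
    using \<psi> grpN by (auto simp: iso_def intro!: group_hom.intro group_hom_axioms.intro)
  \<comment> \<open>\<open>1 mod int d\<close> is the class of 1 also for \<open>d = 1\<close>,
    where the carrier consists of 0 alone.\<close>
  define z where "z = \<psi> (1 mod int d)"
  have gen: "1 mod int d \<in> carrier ?Z" using \<open>d > 0\<close> by (simp add: carrier_integer_mod_group)
  have bij: "bij_betw \<psi> {0..<int d} N"
    using \<psi> \<open>d > 0\<close> by (simp add: iso_def carrier_integer_mod_group)
  have z_pow: "z [^] i = \<psi> (int i mod int d)" for i :: nat
  proof -
    have "z [^] i = z [^]\<^bsub>?N\<^esub> i" by (simp add: nat_pow_def)
    also have "\<dots> = \<psi> ((1 mod int d) [^]\<^bsub>?Z\<^esub> i)"
      unfolding z_def using hom_nat_pow[OF gen] by simp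
    also have "\<dots> = \<psi> (int i mod int d)" by (simp add: mod_mult_right_eq)
    finally show ?thesis .
  qed
  have zN: "z \<in> N" using bij_betw_apply[OF bij] \<open>d > 0\<close> by (simp add: z_def)
  then have zG: "z \<in> carrier G" using subgroup.subset[OF assms(1)] by auto
  have "N \<subseteq> generate G {z}"
  proof
    fix x assume "x \<in> N"
    then obtain i where "i \<in> {0..<int d}" "x = \<psi> i" using bij by (auto simp: bij_betw_def)
    then have "x = z [^] int (nat i)" unfolding int_pow_int z_pow by simp
    then show "x \<in> generate G {z}" unfolding G_generate(1)[OF zG] by blast
  qed
  moreover have "generate G {z} \<subseteq> N"
    using assms(1) zN by (intro G_generate(2)) auto
  ultimately have N: "generate G {z} = N" by auto
  moreover have "card N = d" using bij_betw_same_card[OF bij] by simp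
  ultimately show thesis using zG G_generate(3)[OF zG] by (intro that) auto
qed

theorem theorem3p3:
  fixes n h k :: nat and G :: "('a, 'm) monoid_scheme" and N :: "'a set"
  assumes "n > 0" and "h > 0"
    and "[h ^ 2 = 0] (mod n)"
    and "(multiplicity 2 h, multiplicity 2 n) \<noteq> (1, 1)"
    and "real k = (if multiplicity 2 n \<noteq> 1 then real n / real h else 2 * real n / real h)"
    and "k > 0" and "k dvd n"
    and "group G" and "order G = n"
    and "N \<lhd> G" and "G\<lparr>carrier := N\<rparr> \<cong> integer_mod_group (n div k)"
  shows "\<exists>H. BH_matrix G h H"
proof -
  interpret group G by fact
  interpret N: normal N G by fact
  have fin: "finite (carrier G)" using \<open>n > 0\<close> \<open>order G = n\<close> order_gt_0_iff_finite by simp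
  define d where "d = n div k"
  have n: "n = k * d" using \<open>k dvd n\<close> by (simp add: d_def)
  with \<open>n > 0\<close> have "d > 0" by simp
  obtain z where z: "z \<in> carrier G" "generate G {z} = N" "ord z = d"
    using iso_integer_mod_group_generator[OF N.subgroup_axioms assms(11)[folded d_def] \<open>d > 0\<close>] .
  have "z \<in> N" using z(2) by (metis generate.incl singletonI)
  then have conj: "g \<otimes>\<^bsub>G\<^esub> z \<otimes>\<^bsub>G\<^esub> inv\<^bsub>G\<^esub> g \<in> generate G {z}" if "g \<in> carrier G" for g
    using N.inv_op_closed2[OF that] z(2) by simp
  have "n dvd h\<^sup>2" using assms(3) by (simp add: cong_0_iff)
  show ?thesis
  proof (cases "multiplicity 2 n = 1")
    case True
    then have "real k = 2 * real n / real h" using assms(5) by simp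
    then have "real (k * h) = real (2 * n)" using \<open>h > 0\<close> by (simp add: field_simps)
    then have "k * h = k * (2 * d)" by (simp only: of_nat_eq_iff n mult.left_commute)
    with \<open>k > 0\<close> have h: "h = 2 * d" by simp
    have "\<not> 4 dvd n" using True multiplicity_2_eq_1_iff[OF \<open>n > 0\<close>] by simp
    \<comment> \<open>For odd \<open>d\<close>, \<open>h = 2 * d\<close> would have 2-adic valuation
      1, as \<open>n\<close> has: the excluded pair.\<close>
    have "even d"
    proof (rule ccontr)
      assume "odd d"
      then have "\<not> 4 dvd h" unfolding h by presburger
      then have "multiplicity 2 h = 1"
        unfolding multiplicity_2_eq_1_iff[OF \<open>h > 0\<close>] by (simp add: h)
      with True assms(4) show False by simp
    qed
    then obtain e where e: "d = 2 * e" ..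
    with \<open>\<not> 4 dvd n\<close> have "odd k" unfolding n by auto
    \<comment> \<open>Being odd, \<open>k\<close> loses the factor 4 in \<open>k dvd 4 * d\<close>,
      so it divides \<open>d\<close>.\<close>
    have "d * k dvd d * (4 * d)"
      using \<open>n dvd h\<^sup>2\<close> by (simp add: n h power2_eq_square ac_simps)
    with \<open>d > 0\<close> have "k dvd 2 ^ 2 * d" by simp
    moreover have "coprime k (2 ^ 2)" using \<open>odd k\<close>
      by (simp only: coprime_power_right_iff coprime_right_2_iff_odd simp_thms)
    ultimately have "k dvd d" by (simp add: coprime_dvd_mult_right_iff)
    then obtain m where "d = k * m" ..
    \<comment> \<open>The extra factor 2 in \<open>h = 2 * k * m\<close> gives
      \<open>2 * m dvd h\<close>.\<close>
    show ?thesis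
      by (rule BH_matrix_exists_if_normalized_cyclic[OF fin z(1) conj, of k m])
         (use z \<open>order G = n\<close> n \<open>d = k * m\<close> h \<open>h > 0\<close> in auto)
  next
    case False
    then have "real k = real n / real h" using assms(5) by simp
    then have "real (k * h) = real n" using \<open>h > 0\<close> by (simp add: field_simps)
    then have "k * h = k * d" unfolding of_nat_eq_iff by (simp add: n)
    with \<open>k > 0\<close> have h: "h = d" by simp
    have "d * k dvd d * d" using \<open>n dvd h\<^sup>2\<close> by (simp add: n h power2_eq_square ac_simps)
    with \<open>d > 0\<close> have "k dvd d" by simp
    then obtain m where m: "d = k * m" ..
    \<comment> \<open>With \<open>h = k * m\<close>, the condition \<open>2 * m dvd h\<close> for
      even \<open>m\<close> is immediate when \<open>k\<close> is even; only even \<open>m\<close>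
      with odd \<open>k\<close> needs another subgroup.\<close>
    show ?thesis
    proof (cases "even m \<and> odd k")
      case False
      show ?thesis
        by (rule BH_matrix_exists_if_normalized_cyclic[OF fin z(1) conj, of k m])
           (use z \<open>order G = n\<close> n m h \<open>h > 0\<close> False in auto)
    next
      case True
      txt \<open>Here \<open>2 * m\<close> need not divide \<open>h\<close>, so \<open>N\<close> is replaced by its subgroup of index 2.\<close>
      have "4 dvd n" 
        using \<open>multiplicity 2 n \<noteq> 1\<close> True multiplicity_2_eq_1_iff[OF \<open>n > 0\<close>]
        by (simp add: n m)
      \<comment> \<open>Since \<open>k * k\<close> is odd, the factor 4 of \<open>n\<close> lies in
        \<open>m\<close>.\<close>
      then have "2 ^ 2 dvd (k * k) * m" by (simp add: n m ac_simps)
      moreover have "coprime (2 ^ 2) (k * k)" using True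
        by (simp only: coprime_power_left_iff coprime_left_2_iff_odd even_mult_iff simp_thms)
      ultimately have "2 ^ 2 dvd m" by (simp only: coprime_dvd_mult_right_iff)
      then obtain m' where m': "m = 2 ^ 2 * m'" ..
      have ord2: "ord (z [^]\<^bsub>G\<^esub> (2::nat)) = 2 * k * m'"
        using z by (subst ord_pow) (auto simp: m m')
      have conj2: "g \<otimes>\<^bsub>G\<^esub> z [^]\<^bsub>G\<^esub> (2::nat) \<otimes>\<^bsub>G\<^esub> inv\<^bsub>G\<^esub> g \<in> generate G {z [^]\<^bsub>G\<^esub> (2::nat)}"
        if g: "g \<in> carrier G" for g
      proof -
        obtain i :: nat where "g \<otimes>\<^bsub>G\<^esub> z \<otimes>\<^bsub>G\<^esub> inv\<^bsub>G\<^esub> g = z [^]\<^bsub>G\<^esub> i"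
          using conj[OF g] generate_pow_on_finite_carrier[OF fin z(1)] by auto
        then have "g \<otimes>\<^bsub>G\<^esub> z [^]\<^bsub>G\<^esub> (2::nat) \<otimes>\<^bsub>G\<^esub> inv\<^bsub>G\<^esub> g = (z [^]\<^bsub>G\<^esub> (2::nat)) [^]\<^bsub>G\<^esub> i"
          using g z(1) by (simp add: nat_pow_conj nat_pow_pow mult.commute)
        then show ?thesis
          using generate_pow_on_finite_carrier[OF fin, of "z [^]\<^bsub>G\<^esub> (2::nat)"] z(1) by auto
      qed
      \<comment> \<open>The index doubles to \<open>2 * k\<close> and the order is
        \<open>2 * k * m'\<close>, so \<open>2 * k\<close> and \<open>m'\<close> replace
        \<open>k\<close> and \<open>m\<close>; now \<open>h = 4 * k * m'\<close> is divisible by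
        \<open>2 * m'\<close>.\<close>
      show ?thesis
        by (rule BH_matrix_exists_if_normalized_cyclic[OF fin _ conj2, of "2 * k" m'])
           (use z \<open>order G = n\<close> n m m' h \<open>h > 0\<close> ord2 in auto)
    qed
  qed
qed

end
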